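(* Let $0<\alpha<1$, $L>0$, $k>0$, and let $G$ be a directed, strongly connected and detail-balanced graph with $N$ nodes and adjacency matrix $A=(a_{ij})$; let $\omega=[\omega_1,\dots,\omega_N]^T$ be a vector with $\omega_i>0$ and $\omega_ia_{ij}=\omega_ja_{ji}$ for all $i,j=1,\dots,N$. Consider the multi-agent system, for $x\in[0,L]$, $t\ge 0$, $i=1,\dots,N$, $$y_{i,t}(x,t)=k\,y_{i,xx}(x,t)+u_i(x,t),\qquad y_i(0,t)=y_i(L,t)=0,\qquad y_i(x,0)=y_i^0(x),$$ where each $y_i^0$ is bounded and continuous on $[0,L]$, with controller $$u_i(x,t)=-\sum_{j=1}^{N}a_{ij}\left(\int_0^L\xi_{ij}(x,t)^{2}\,\mathrm{d}x\right)^{\alpha-1}\xi_{ij}(x,t),\qquad \xi_{ij}(x,t)=y_i(x,t)-y_j(x,t).$$ Then the system achieves finite-time consensus, and the finite terminal time $t^*$ satisfies $$t^*\le\frac{\left[\int_0^L\sum_{i=1}^{N}\omega_i\,(y_i^0(x)-\hat y^0(x))^2\,\mathrm{d}x\right]^{1-\alpha}}{C_3(1-\alpha)},$$ where $$\hat y^0(x)=\frac{1}{\sum_{i=1}^N\omega_i}\sum_{i=1}^N\omega_iy_i^0(x),\qquad C_3=\left(\frac{2}{\max_{i=1,\dots,N}\omega_i}\,\lambda_\omega(\mathcal L(D))\right)^{\alpha},\qquad D=\left((\omega_ia_{ij})^{1/\alpha}\right)\in\mathbb R^{N\times N}.$$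
   Context: Graph: $G=\{\mathfrak V,\mathfrak E,A\}$ has vertices $v_1,\dots,v_N$ and nonnegative adjacency matrix $A=(a_{ij})$, with $a_{ij}>0$ if node $v_i$ can receive data from $v_j$ (i.e. $(v_j,v_i)\in\mathfrak E$, $v_j\in N_i$), and $a_{ij}=0$ otherwise. A directed graph is strongly connected if for any pair $v_i,v_j$ there is a sequence $a_{ii_1},a_{i_1i_2},\dots,a_{i_mj}$ all of whose elements are positive; it is detail-balanced if there is a vector $\omega=[\omega_1,\dots,\omega_N]^T$ with $\omega_i>0$ and $\omega_ia_{ij}=\omega_ja_{ji}$ for all $i,j$. Laplacian: for a nonnegative matrix $M=(m_{ij})$ viewed as an adjacency matrix, $\mathcal L(M)=(l_{ij})$ with $l_{ij}=-m_{ij}$ for $j\neq i$ and $l_{ii}=\sum_{j\ne i}m_{ij}$. For symmetric $\mathcal L(M)$, $\lambda_\omega(\mathcal L(M))=\min_{x\ne0,\ \langle x,\omega\rangle=0}\frac{\langle x,\mathcal L(M)x\rangle}{\langle x,x\rangle}$. Finite-time consensus (FTC): the system achieves FTC if there exists a finite time $t^*$ such that $\lim_{t\to t^*}|y_i(x,t)-y_j(x,t)|=0$ for any $x\in[0,L]$ and $i,j=1,\dots,N$. This $t^*$ is the terminal time. Subscripts $t$, $xx$ denote partial derivatives. The term $\left(\int_0^L\xi_{ij}^2\,\mathrm dx\right)^{\alpha-1}\xi_{ij}$ is read as $0$ when $\xi_{ij}(\cdot,t)\equiv0$ (in particular for $i=j$). *)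

theory Defs
  imports "HOL-Analysis.Analysis"
begin

section \<open>Weighted digraphs given by an adjacency matrix\<close>

text \<open>
  The nodes are the elements of the finite index type, so \<open>N = CARD('n)\<close>. The entry
  \<open>A $ i $ j\<close> is positive iff node \<open>i\<close> receives data from node \<open>j\<close>; the edge set is
  therefore determined by the matrix.
\<close>

definition nonneg_matrix :: "real^'n^'n \<Rightarrow> bool" where
  "nonneg_matrix A \<longleftrightarrow> (\<forall>i j. 0 \<le> A $ i $ j)"

definition strongly_connected :: "real^'n^'n \<Rightarrow> bool" where
  "strongly_connected A \<longleftrightarrow> (\<forall>i j. i \<noteq> j \<longrightarrow> (i, j) \<in> {(p, q). A $ p $ q > 0}\<^sup>+)"

definition balances :: "real^'n \<Rightarrow> real^'n^'n \<Rightarrow> bool" where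
  "balances \<omega> A \<longleftrightarrow>
     (\<forall>i. \<omega> $ i > 0) \<and> (\<forall>i j. \<omega> $ i * A $ i $ j = \<omega> $ j * A $ j $ i)"

definition detail_balanced :: "real^'n^'n \<Rightarrow> bool" where
  "detail_balanced A \<longleftrightarrow> (\<exists>\<omega>. balances \<omega> A)"

definition laplacian :: "real^'n^'n \<Rightarrow> real^'n^'n" where
  "laplacian M = (\<chi> i j. if i = j then (\<Sum>p\<in>UNIV - {i}. M $ i $ p) else - M $ i $ j)"

text \<open>
  For \<open>CARD('n) = 1\<close> no nonzero vector is orthogonal to \<open>\<omega>\<close> and the minimum is an
  unspecified real number.
\<close>

definition lambda_omega :: "real^'n \<Rightarrow> real^'n^'n \<Rightarrow> real" where
  "lambda_omega \<omega> M =
     (LEAST r. \<exists>x. x \<noteq> 0 \<and> x \<bullet> \<omega> = 0 \<and> r = (x \<bullet> (M *v x)) / (x \<bullet> x))"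

definition D_matrix :: "real \<Rightarrow> real^'n \<Rightarrow> real^'n^'n \<Rightarrow> real^'n^'n" where
  "D_matrix \<alpha> \<omega> A = (\<chi> i j. (\<omega> $ i * A $ i $ j) powr (1 / \<alpha>))"

definition C3 :: "real \<Rightarrow> real^'n \<Rightarrow> real^'n^'n \<Rightarrow> real" where
  "C3 \<alpha> \<omega> A =
     (2 / Max (range (\<lambda>i. \<omega> $ i)) * lambda_omega \<omega> (laplacian (D_matrix \<alpha> \<omega> A))) powr \<alpha>"

definition weighted_mean :: "real^'n \<Rightarrow> ('n \<Rightarrow> real \<Rightarrow> real) \<Rightarrow> real \<Rightarrow> real" where
  "weighted_mean \<omega> y0 x = 1 / (\<Sum>i\<in>UNIV. \<omega> $ i) * (\<Sum>i\<in>UNIV. \<omega> $ i * y0 i x)"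


section \<open>The closed-loop multi-agent system\<close>

text \<open>The state is a function \<open>y i x t\<close> of agent, position and time.\<close>

definition xi :: "('n \<Rightarrow> real \<Rightarrow> real \<Rightarrow> real) \<Rightarrow> 'n \<Rightarrow> 'n \<Rightarrow> real \<Rightarrow> real \<Rightarrow> real" where
  "xi y i j x t = y i x t - y j x t"

text \<open>
  If \<open>xi y i j\<close> vanishes identically at time \<open>t\<close>, the corresponding summand is \<open>0\<close> because
  its second factor is.
\<close>

definition control ::
  "real \<Rightarrow> real \<Rightarrow> real^'n^'n \<Rightarrow> ('n \<Rightarrow> real \<Rightarrow> real \<Rightarrow> real) \<Rightarrow> 'n \<Rightarrow> real \<Rightarrow> real \<Rightarrow> real" where
  "control \<alpha> L A y i x t =
     - (\<Sum>j\<in>UNIV. A $ i $ j *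
          (integral {0..L} (\<lambda>s. (xi y i j s t)\<^sup>2)) powr (\<alpha> - 1) * xi y i j x t)"

text \<open>
  Solutions are classical for positive times, with two provisos.

  The \<open>L\<^sup>2\<close> norm of a summand of the controller is proportional to the power
  \<open>2 * \<alpha> - 1\<close> of the norm of \<open>xi y i j\<close>. For \<open>\<alpha> \<le> 1/2\<close> it does not tend to \<open>0\<close> with
  \<open>xi y i j\<close>, and the time derivative of a solution does in general not exist at the instant
  at which two agents meet. The equation is therefore required only outside
  some closed countable set \<open>S\<close> of times, across which the state is continuous. Taking
  \<open>S = {}\<close> gives the solutions for which the equation holds at all positive times.

  The initial profiles need not vanish at the end points. The boundary condition is hence
  imposed for \<open>t > 0\<close>, and at the corners \<open>(0,0)\<close> and \<open>(L,0)\<close> the state need not be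
  continuous but only locally bounded.
\<close>

definition solution ::
  "real \<Rightarrow> real \<Rightarrow> real \<Rightarrow> real^'n^'n \<Rightarrow> ('n \<Rightarrow> real \<Rightarrow> real) \<Rightarrow>
    ('n \<Rightarrow> real \<Rightarrow> real \<Rightarrow> real) \<Rightarrow> bool" where
  "solution \<alpha> L k A y0 y \<longleftrightarrow>
     (\<forall>i. \<forall>x\<in>{0..L}. y i x 0 = y0 i x) \<and>
     (\<forall>i. \<forall>t>0. y i 0 t = 0 \<and> y i L t = 0) \<and>
     (\<forall>i. continuous_on ({0..L} \<times> {0..} - {(0, 0), (L, 0)}) (\<lambda>(x, t). y i x t)) \<and>
     (\<forall>i. \<forall>T. bounded ((\<lambda>(x, t). y i x t) ` ({0..L} \<times> {0..T}))) \<and>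
     (\<exists>S y_t y_x y_xx. closed S \<and> countable S \<and>
        (\<forall>i. continuous_on ({0..L} \<times> ({0<..} - S)) (\<lambda>(x, t). y_t i x t)) \<and>
        (\<forall>i. \<forall>x\<in>{0..L}. \<forall>t\<in>{0<..} - S.
           ((\<lambda>s. y i x s) has_real_derivative y_t i x t) (at t) \<and>
           ((\<lambda>z. y i z t) has_real_derivative y_x i x t) (at x within {0..L}) \<and>
           ((\<lambda>z. y_x i z t) has_real_derivative y_xx i x t) (at x within {0..L}) \<and>
           y_t i x t = k * y_xx i x t + control \<alpha> L A y i x t))"

text \<open>
  Time ranges over the nonnegative reals, so the limit is two-sided for \<open>tstar > 0\<close> and
  one-sided for \<open>tstar = 0\<close>.
\<close>

definition terminal_time :: "real \<Rightarrow> ('n \<Rightarrow> real \<Rightarrow> real \<Rightarrow> real) \<Rightarrow> real \<Rightarrow> bool" where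
  "terminal_time L y tstar \<longleftrightarrow> 0 \<le> tstar \<and>
     (\<forall>x\<in>{0..L}. \<forall>i j. ((\<lambda>t. \<bar>y i x t - y j x t\<bar>) \<longlongrightarrow> 0) (at tstar within {0..}))"

definition achieves_FTC :: "real \<Rightarrow> ('n \<Rightarrow> real \<Rightarrow> real \<Rightarrow> real) \<Rightarrow> bool" where
  "achieves_FTC L y \<longleftrightarrow> (\<exists>tstar. terminal_time L y tstar)"

end

theory Submission
  imports Defs
begin

text \<open>
  The \<open>\<omega>\<close>-weighted squared distance \<open>V\<close> of the state from its weighted mean is a Lyapunov
  function. Detailed balance makes the weighted mean a plain solution of the heat equation, and
  diffusion only decreases \<open>V\<close> (integration by parts). The controller contributes
  \<open>- \<Sum>i j. \<omega>\<^sub>i a\<^sub>i\<^sub>j (\<integral> \<xi>\<^sub>i\<^sub>j\<^sup>2)\<^sup>\<alpha>\<close> to the derivative. Subadditivity of \<open>s \<mapsto> s\<^sup>\<alpha>\<close> moves the sum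
  inside the power, which turns the weights into the entries of \<open>D\<close>, and the spectral bound for
  the Laplacian of \<open>D\<close> gives \<open>V' \<le> - C3 V\<^sup>\<alpha>\<close>. This forces \<open>V = 0\<close> from the time
  \<open>V(0)\<^sup>1\<^sup>-\<^sup>\<alpha> / (C3 (1 - \<alpha>))\<close> on. The countable set of exceptional times is harmless because
  \<open>V\<close> is continuous.
\<close>

section \<open>Real-variable tools: monotonicity, finite-time extinction, subadditivity of
  powers\<close>

text \<open>If \<open>f\<close> rose, it would still rise after subtracting a small linear term. The
  tilted function takes only countably many values on \<open>S\<close>, so some level between its
  end values is avoided there. At the last crossing of that level its derivative is negative, yet
  its later values are larger.\<close>

lemma nonincreasing_off_countable:
  fixes f :: "real \<Rightarrow> real"
  assumes "a \<le> b" and cont: "continuous_on {a..b} f" and "countable S"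
    and deriv: "\<And>t. t \<in> {a<..<b} - S \<Longrightarrow> \<exists>D\<le>0. (f has_real_derivative D) (at t)"
  shows "f b \<le> f a"
proof (rule ccontr)
  assume "\<not> f b \<le> f a"
  then have less: "f a < f b" by simp
  with \<open>a \<le> b\<close> have "a < b" by (cases "a = b") auto
  \<comment> \<open>Half the mean slope of \<open>f\<close>: small enough to keep
    \<open>g a < g b\<close>, positive so that \<open>g\<close> has a strictly negative derivative
    off \<open>S\<close>.\<close>
  define e where "e = (f b - f a) / (2 * (b - a))"
  have "e > 0" using less \<open>a < b\<close> by (simp add: e_def)
  define g where "g t = f t - e * (t - a)" for t
  have "e * (b - a) = (f b - f a) / 2" using \<open>a < b\<close> by (simp add: e_def field_simps)
  then have "g a < g b" using less by (simp add: g_def)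
  have contg: "continuous_on {a..b} g"
    unfolding g_def by (intro continuous_intros cont)
  have "countable (g ` S)" using \<open>countable S\<close> by simp
  \<comment> \<open>A level that \<open>g\<close> does not take on \<open>S\<close>; its last crossing is then a point of differentiability.\<close>
  then obtain c where c: "g a < c" "c < g b" "c \<notin> g ` S"
    using real_interval_avoid_countable_set[OF \<open>g a < g b\<close>]
    by (metis greaterThanLessThan_iff)
  define T where "T = {t \<in> {a..b}. g t \<le> c}"
  have "T = {a..b} \<inter> g -` {..c}" by (auto simp: T_def)
  then have "closed T"
    using continuous_closed_preimage[OF contg closed_atLeastAtMost closed_atMost] by simp
  moreover have Tb: "bdd_above T" unfolding T_def by (rule bdd_aboveI[of _ b]) auto
  moreover have "a \<in> T" using c \<open>a < b\<close> by (simp add: T_def)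
  ultimately have x: "Sup T \<in> T" using closed_contains_Sup by blast
  define x where "x = Sup T"
  have xT: "x \<in> {a..b}" "g x \<le> c" using x by (auto simp: T_def x_def)
  have after: "c < g t" if "x < t" "t \<le> b" for t
    using cSup_upper[OF _ Tb, of t] that xT by (fastforce simp: T_def x_def)
  \<comment> \<open>If \<open>g x < c\<close>, the level \<open>c\<close> would be taken somewhere
    after \<open>x\<close>, where \<open>g\<close> exceeds \<open>c\<close>. Hence \<open>z\<close>
    is \<open>x\<close> itself.\<close>
  obtain z where z: "x \<le> z" "z \<le> b" "g z = c"
    using IVT'[of g x c b] xT c continuous_on_subset[OF contg, of "{x..b}"] by auto
  with after[of z] have "g x = c" by (cases "x = z") auto
  with c have "x \<noteq> a" "x \<noteq> b" "x \<notin> S" by auto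
  with xT obtain D where "D \<le> 0" "(f has_real_derivative D) (at x)"
    using deriv[of x] by auto
  then have "(g has_real_derivative (D - e)) (at x)" "D - e < 0"
    unfolding g_def using \<open>e > 0\<close> by (auto intro!: derivative_eq_intros)
  from has_real_derivative_neg_dec_right[OF this]
  obtain d where d: "d > 0" "\<And>h. 0 < h \<Longrightarrow> h < d \<Longrightarrow> g (x + h) < g x" by auto
  define h where "h = min (d / 2) (b - x)"
  have "0 < h" "h < d" "x + h \<le> b"
    using d xT \<open>x \<noteq> b\<close> by (auto simp: h_def min_def)
  with d(2)[of h] after[of "x + h"] \<open>g x = c\<close> show False by auto
qed

text \<open>While \<open>V\<close> is positive, the derivative of
  \<open>V powr (1 - \<alpha>)\<close> is at most \<open>- C * (1 - \<alpha>)\<close> off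
  \<open>S\<close>, so this power is exhausted by the stated time.\<close>

lemma finite_time_extinction:
  fixes V :: "real \<Rightarrow> real"
  assumes "0 < \<alpha>" "\<alpha> < 1" "C > 0" "countable S"
    and cont: "continuous_on {0..} V" and nonneg: "\<And>t. t \<ge> 0 \<Longrightarrow> V t \<ge> 0"
    and deriv: "\<And>t. t \<in> {0<..} - S \<Longrightarrow> \<exists>D\<le>- C * V t powr \<alpha>. (V has_real_derivative D) (at t)"
    and t: "V 0 powr (1 - \<alpha>) / (C * (1 - \<alpha>)) \<le> t"
  shows "V t = 0"
proof (rule ccontr)
  assume "V t \<noteq> 0"
  have "0 \<le> V 0 powr (1 - \<alpha>) / (C * (1 - \<alpha>))" using assms by simp
  with t have "t \<ge> 0" by linarith
  with nonneg \<open>V t \<noteq> 0\<close> have "V t > 0" by (simp add: order_less_le)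
  \<comment> \<open>\<open>V\<close> is nonincreasing, so positivity at \<open>t\<close> spreads to
    all earlier times and keeps the power away from its singularity at 0.\<close>
  have pos: "V s > 0" if "s \<in> {0..t}" for s
  proof -
    have "V t \<le> V s"
    proof (rule nonincreasing_off_countable[where f = V and S = S])
      fix r assume "r \<in> {s<..<t} - S"
      then have "r \<in> {0<..} - S" using that by auto
      from deriv[OF this] obtain D where D: "D \<le> - C * V r powr \<alpha>" "(V has_real_derivative D) (at r)"
        by blast
      have "0 \<le> C * V r powr \<alpha>" using \<open>C > 0\<close> by simp
      with D show "\<exists>D\<le>0. (V has_real_derivative D) (at r)" by (intro exI[of _ D]) auto
    qed (use that \<open>countable S\<close> in \<open>auto intro: continuous_on_subset[OF cont]\<close>)
    with \<open>V t > 0\<close> show ?thesis by simp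
  qed
  \<comment> \<open>Adding the guaranteed linear loss turns the differential inequality into
    monotonicity of \<open>W\<close>.\<close>
  define W where "W s = V s powr (1 - \<alpha>) + C * (1 - \<alpha>) * s" for s
  have "W t \<le> W 0"
  proof (rule nonincreasing_off_countable[where f = W and S = S])
    show "continuous_on {0..t} W"
      unfolding W_def
      by (intro continuous_intros continuous_on_subset[OF cont]) (use pos in force)+
    fix s assume s: "s \<in> {0<..<t} - S"
    then have "V s > 0" using pos by auto
    from s deriv[of s] obtain D where D: "D \<le> - C * V s powr \<alpha>" "(V has_real_derivative D) (at s)"
      by auto
    let ?D = "(1 - \<alpha>) * V s powr (- \<alpha>) * D + C * (1 - \<alpha>)"
    have "((\<lambda>s. V s powr (1 - \<alpha>)) has_real_derivative (1 - \<alpha>) * V s powr (- \<alpha>) * D) (at s)"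
      using DERIV_fun_powr[OF D(2) \<open>V s > 0\<close>, of "1 - \<alpha>"] by simp
    then have "(W has_real_derivative ?D) (at s)"
      unfolding W_def by (rule DERIV_add) (auto intro!: derivative_eq_intros)
    moreover have "V s powr (- \<alpha>) * D \<le> V s powr (- \<alpha>) * (- C * V s powr \<alpha>)"
      using D by (intro mult_left_mono) auto
    then have "V s powr (- \<alpha>) * D \<le> - C"
      using \<open>V s > 0\<close> by (simp add: powr_minus field_simps)
    then have "(1 - \<alpha>) * (V s powr (- \<alpha>) * D) \<le> (1 - \<alpha>) * (- C)"
      using \<open>\<alpha> < 1\<close> by (intro mult_left_mono) auto
    then have "?D \<le> 0" by (simp add: algebra_simps)
    ultimately show "\<exists>D\<le>0. (W has_real_derivative D) (at s)" by blast
  qed (use \<open>t \<ge> 0\<close> \<open>countable S\<close> in auto)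
  moreover have "V 0 powr (1 - \<alpha>) \<le> C * (1 - \<alpha>) * t"
    using t \<open>C > 0\<close> \<open>\<alpha> < 1\<close> by (simp add: field_simps)
  ultimately have "V t powr (1 - \<alpha>) \<le> 0" unfolding W_def by linarith
  with \<open>V t > 0\<close> show False by simp
qed

text \<open>After division by the total all terms lie between 0 and 1, where
  \<open>u \<le> u powr \<alpha>\<close>, and they sum to 1.\<close>

lemma powr_sum_le_sum_powr:
  fixes f :: "'a \<Rightarrow> real"
  assumes "0 < \<alpha>" "\<alpha> \<le> 1" "finite I" and nonneg: "\<And>i. i \<in> I \<Longrightarrow> 0 \<le> f i"
  shows "(\<Sum>i\<in>I. f i) powr \<alpha> \<le> (\<Sum>i\<in>I. f i powr \<alpha>)"
proof (cases "sum f I = 0")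
  case True
  then show ?thesis by (simp add: sum_nonneg)
next
  case False
  define s where "s = sum f I"
  have "s > 0" using False sum_nonneg[of I f] nonneg by (simp add: s_def order_less_le)
  have le: "f i / s \<le> (f i / s) powr \<alpha>" if "i \<in> I" for i
  proof -
    have "f i \<le> s" unfolding s_def using that assms by (intro member_le_sum) auto
    then show ?thesis
      using \<open>s > 0\<close> nonneg[OF that] powr_mono'[of \<alpha> 1 "f i / s"] assms by auto
  qed
  have "1 = (\<Sum>i\<in>I. f i / s)" using \<open>s > 0\<close> by (simp add: s_def sum_divide_distrib[symmetric])
  also have "\<dots> \<le> (\<Sum>i\<in>I. (f i / s) powr \<alpha>)" by (intro sum_mono le)
  also have "\<dots> = (\<Sum>i\<in>I. f i powr \<alpha>) / s powr \<alpha>"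
    using \<open>s > 0\<close> nonneg by (simp add: powr_divide sum_divide_distrib)
  finally show ?thesis using \<open>s > 0\<close> by (simp add: s_def field_simps)
qed

section \<open>Weighted graph sums and the spectrum of the Laplacian\<close>

text \<open>Add the sum to its copy with \<open>i\<close> and \<open>j\<close> exchanged. The
  weights are arbitrary because the identity serves both the Laplacian and the state-dependent
  weights of the controller.\<close>

lemma sum_weighted_differences:
  fixes w :: "'n::finite \<Rightarrow> 'n \<Rightarrow> real"
  assumes "\<And>i j. w i j = w j i"
  shows "2 * (\<Sum>i\<in>UNIV. \<Sum>j\<in>UNIV. w i j * d i * (d i - d j))
       = (\<Sum>i\<in>UNIV. \<Sum>j\<in>UNIV. w i j * (d i - d j)\<^sup>2)"
proof -
  let ?X = "\<Sum>i\<in>UNIV. \<Sum>j\<in>UNIV. w i j * d i * (d i - d j)"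
  have "?X = (\<Sum>i\<in>UNIV. \<Sum>j\<in>UNIV. w j i * d j * (d j - d i))" by (rule sum.swap)
  also have "\<dots> = (\<Sum>i\<in>UNIV. \<Sum>j\<in>UNIV. w i j * d j * (d j - d i))" by (intro sum.cong refl) (simp add: assms)
  finally have "2 * ?X = ?X + (\<Sum>i\<in>UNIV. \<Sum>j\<in>UNIV. w i j * d j * (d j - d i))" by simp
  also have "\<dots> = (\<Sum>i\<in>UNIV. \<Sum>j\<in>UNIV. w i j * (d i - d j)\<^sup>2)"
    unfolding sum.distrib[symmetric]
    by (intro sum.cong refl) (simp add: power2_eq_square algebra_simps)
  finally show ?thesis .
qed

lemma laplacian_mult_vec:
  "(laplacian M *v x) $ i = (\<Sum>j\<in>UNIV. M $ i $ j * (x $ i - x $ j))"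
proof -
  have "(laplacian M *v x) $ i
      = (\<Sum>j\<in>UNIV. (if i = j then (\<Sum>p\<in>UNIV - {i}. M $ i $ p) else - M $ i $ j) * x $ j)"
    by (simp add: laplacian_def matrix_vector_mult_def)
  also have "\<dots> = (\<Sum>p\<in>UNIV - {i}. M $ i $ p) * x $ i + (\<Sum>j\<in>UNIV - {i}. - M $ i $ j * x $ j)"
    by (subst sum.remove[of _ i]) (auto intro!: sum.cong)
  also have "\<dots> = (\<Sum>j\<in>UNIV - {i}. M $ i $ j * (x $ i - x $ j))"
    by (simp add: sum_distrib_right sum_distrib_left sum_subtractf algebra_simps sum_negf)
  also have "\<dots> = (\<Sum>j\<in>UNIV. M $ i $ j * (x $ i - x $ j))"
    by (subst sum.remove[of UNIV i]) auto
  finally show ?thesis .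
qed

text \<open>This is the Dirichlet form of the graph; for nonnegative \<open>M\<close> it shows that
  the quadratic form is nonnegative and where it vanishes.\<close>

lemma inner_laplacian:
  assumes "\<And>i j. M $ i $ j = M $ j $ i"
  shows "2 * (x \<bullet> (laplacian M *v x)) = (\<Sum>i\<in>UNIV. \<Sum>j\<in>UNIV. M $ i $ j * (x $ i - x $ j)\<^sup>2)"
proof -
  have "x \<bullet> (laplacian M *v x) = (\<Sum>i\<in>UNIV. \<Sum>j\<in>UNIV. M $ i $ j * x $ i * (x $ i - x $ j))"
    by (simp add: inner_vec_def laplacian_mult_vec sum_distrib_left algebra_simps)
  then show ?thesis
    using sum_weighted_differences[of "\<lambda>i j. M $ i $ j" "\<lambda>i. x $ i"] assms by simp
qed

text \<open>\<open>LEAST\<close> on the reals is meaningful only if the minimum exists. The unit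
  vectors orthogonal to \<open>\<omega>\<close> form a compact set on which the quadratic form
  attains its infimum, and homogeneity extends the bound to all orthogonal vectors.\<close>

lemma lambda_omega_attained:
  fixes \<omega> :: "real^'n"
  assumes "CARD('n) \<ge> 2"
  obtains x where "x \<noteq> 0" "x \<bullet> \<omega> = 0" "lambda_omega \<omega> M = (x \<bullet> (M *v x)) / (x \<bullet> x)"
    "\<And>z. z \<bullet> \<omega> = 0 \<Longrightarrow> lambda_omega \<omega> M * (z \<bullet> z) \<le> z \<bullet> (M *v z)"
proof -
  let ?K = "{x. x \<bullet> \<omega> = 0} \<inter> sphere 0 1"
  let ?q = "\<lambda>x. x \<bullet> (M *v x)"
  have "compact ?K" by (intro closed_Int_compact) (auto intro!: closed_Collect_eq continuous_intros)
  \<comment> \<open>Two nodes give dimension at least 2, which makes the compact set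
    nonempty.\<close>
  moreover obtain v where v: "v \<noteq> 0" "v \<bullet> \<omega> = 0"
    using orthogonal_to_vector_exists[of \<omega>] assms by (auto simp: orthogonal_def inner_commute)
  then have "v /\<^sub>R norm v \<in> ?K" by simp
  then have "?K \<noteq> {}" by blast
  moreover have "continuous_on ?K ?q"
    by (intro continuous_intros matrix_vector_mult_linear_continuous_on)
  ultimately obtain x where x: "x \<in> ?K" "\<And>z. z \<in> ?K \<Longrightarrow> ?q x \<le> ?q z"
    using continuous_attains_inf[of ?K ?q] by blast
  have "x \<noteq> 0" "x \<bullet> x = 1" using x(1) by (auto simp: dot_square_norm)
  have le: "?q x * (z \<bullet> z) \<le> ?q z" if "z \<bullet> \<omega> = 0" for z
  proof (cases "z = 0")
    case False
    then have "z /\<^sub>R norm z \<in> ?K" using that by simp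
    from x(2)[OF this] have "?q x \<le> ?q z / (norm z)\<^sup>2"
      by (simp add: matrix_vector_mult_scaleR power2_eq_square field_simps)
    then show ?thesis using False by (simp add: dot_square_norm field_simps)
  qed simp
  have "lambda_omega \<omega> M = ?q x"
    unfolding lambda_omega_def
  proof (rule Least_equality)
    show "\<exists>z. z \<noteq> 0 \<and> z \<bullet> \<omega> = 0 \<and> ?q x = ?q z / (z \<bullet> z)"
      using x(1) \<open>x \<noteq> 0\<close> \<open>x \<bullet> x = 1\<close> by (intro exI[of _ x]) auto
  next
    fix r assume "\<exists>z. z \<noteq> 0 \<and> z \<bullet> \<omega> = 0 \<and> r = ?q z / (z \<bullet> z)"
    then show "?q x \<le> r" using le by (auto simp: pos_le_divide_eq)
  qed
  with that[of x] x(1) \<open>x \<noteq> 0\<close> \<open>x \<bullet> x = 1\<close> le show ?thesis by auto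
qed

text \<open>If the minimum were 0, every term of the Dirichlet form would vanish at a minimiser. Its
  entries would agree along edges and, by strong connectivity, everywhere; but a constant vector
  orthogonal to a positive \<open>\<omega>\<close> is 0.\<close>

lemma lambda_omega_laplacian_pos:
  fixes \<omega> :: "real^'n" and M :: "real^'n^'n"
  assumes "CARD('n) \<ge> 2" and sym: "\<And>i j. M $ i $ j = M $ j $ i"
    and "nonneg_matrix M" "strongly_connected M" and pos: "\<And>i. \<omega> $ i > 0"
  shows "lambda_omega \<omega> (laplacian M) > 0"
proof -
  obtain x where x: "x \<noteq> 0" "x \<bullet> \<omega> = 0"
    "lambda_omega \<omega> (laplacian M) = (x \<bullet> (laplacian M *v x)) / (x \<bullet> x)"
    using lambda_omega_attained[OF assms(1)] by metis
  have nonneg: "0 \<le> M $ i $ j * (x $ i - x $ j)\<^sup>2" for i j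
    using \<open>nonneg_matrix M\<close> by (simp add: nonneg_matrix_def)
  have ge: "0 \<le> x \<bullet> (laplacian M *v x)"
    using inner_laplacian[of M x, OF sym] nonneg
    by (smt (verit) sum_nonneg)
  have "x \<bullet> (laplacian M *v x) \<noteq> 0"
  proof
    assume "x \<bullet> (laplacian M *v x) = 0"
    then have "(\<Sum>i\<in>UNIV. \<Sum>j\<in>UNIV. M $ i $ j * (x $ i - x $ j)\<^sup>2) = 0"
      using inner_laplacian[of M x, OF sym] by simp
    then have zero: "M $ i $ j * (x $ i - x $ j)\<^sup>2 = 0" for i j
      using nonneg by (simp add: sum_nonneg_eq_0_iff sum_nonneg)
    have "x $ i = x $ j" if "(i, j) \<in> {(p, q). M $ p $ q > 0}\<^sup>+" for i j
      using that
    proof induction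
      case (base j) then show ?case using zero[of i j] by auto
    next
      case (step j l) then show ?case using zero[of j l] by auto
    qed
    then have const: "x $ i = x $ j" for i j
      using \<open>strongly_connected M\<close> by (cases "i = j") (auto simp: strongly_connected_def)
    fix i0 :: 'n
    have "x \<bullet> \<omega> = (\<Sum>i\<in>UNIV. x $ i0 * \<omega> $ i)" 
      unfolding inner_vec_def using const by (intro sum.cong) auto
    also have "\<dots> = x $ i0 * (\<Sum>i\<in>UNIV. \<omega> $ i)" by (simp add: sum_distrib_left)
    finally have "x $ i0 * (\<Sum>i\<in>UNIV. \<omega> $ i) = 0" using x by simp
    moreover have "(\<Sum>i\<in>UNIV. \<omega> $ i) > 0" by (rule sum_pos) (use pos in auto)
    ultimately have "x $ i0 = 0" by simp
    then have "x = 0" using const[of _ i0] by (simp add: vec_eq_iff)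
    with x show False by simp
  qed
  with ge x show ?thesis by (simp add: order_less_le)
qed

section \<open>Deviation from the weighted mean\<close>

text \<open>It acts on the values of all agents at one point, so the same linear operator applies to
  states and to their derivatives, and commutes with differentiation.\<close>

definition deviation :: "real^'n \<Rightarrow> ('n \<Rightarrow> real) \<Rightarrow> 'n \<Rightarrow> real" where
  "deviation \<omega> z i = z i - (\<Sum>j\<in>UNIV. \<omega> $ j * z j) / (\<Sum>j\<in>UNIV. \<omega> $ j)"

lemma minus_weighted_mean: "y i x - weighted_mean \<omega> y x = deviation \<omega> (\<lambda>i. y i x) i"
  by (simp add: weighted_mean_def deviation_def)

lemma deviation_diff: "deviation \<omega> z i - deviation \<omega> z j = z i - z j"
  by (simp add: deviation_def)

lemma has_real_derivative_deviation:
  assumes "\<And>i. (z i has_real_derivative z' i) (at x within X)"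
  shows "((\<lambda>s. deviation \<omega> (\<lambda>i. z i s) i) has_real_derivative deviation \<omega> z' i) (at x within X)"
  unfolding deviation_def by (intro DERIV_diff DERIV_cdivide DERIV_sum DERIV_cmult assms)

lemma continuous_on_deviation [continuous_intros]:
  assumes "\<And>i. continuous_on X (\<lambda>s. z s i)"
  shows "continuous_on X (\<lambda>s. deviation \<omega> (z s) i)"
  unfolding deviation_def divide_inverse
  by (intro continuous_on_diff continuous_on_mult_right continuous_on_sum continuous_on_mult_left assms)

lemma sum_deviation:
  fixes \<omega> :: "real^'n"
  assumes "\<And>i. \<omega> $ i > 0"
  shows "(\<Sum>i\<in>UNIV. \<omega> $ i * deviation \<omega> z i) = 0"
proof -
  have "(\<Sum>j\<in>UNIV. \<omega> $ j) > 0" by (rule sum_pos) (use assms in auto)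
  then show ?thesis
    unfolding deviation_def right_diff_distrib sum_subtractf sum_distrib_right[symmetric] by simp
qed

text \<open>The mean of \<open>w\<close> is common to all agents and gets multiplied by the
  vanishing weighted sum of the deviations of \<open>z\<close>. This removes the derivative of the
  mean from the energy balance.\<close>

lemma sum_deviation_mult:
  fixes \<omega> :: "real^'n"
  assumes "\<And>i. \<omega> $ i > 0"
  shows "(\<Sum>i\<in>UNIV. \<omega> $ i * deviation \<omega> z i * deviation \<omega> w i)
       = (\<Sum>i\<in>UNIV. \<omega> $ i * deviation \<omega> z i * w i)"
proof -
  define m where "m = (\<Sum>j\<in>UNIV. \<omega> $ j * w j) / (\<Sum>j\<in>UNIV. \<omega> $ j)"
  have "(\<Sum>i\<in>UNIV. \<omega> $ i * deviation \<omega> z i * deviation \<omega> w i)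
      = (\<Sum>i\<in>UNIV. \<omega> $ i * deviation \<omega> z i * w i) - (\<Sum>i\<in>UNIV. \<omega> $ i * deviation \<omega> z i) * m"
    unfolding deviation_def[of \<omega> w] m_def[symmetric]
    by (simp add: right_diff_distrib sum_subtractf sum_distrib_right)
  then show ?thesis using sum_deviation[OF assms] by simp
qed

section \<open>Spectral bound for the matrix \<open>D_matrix\<close>\<close>

lemma D_matrix_sym:
  assumes "balances \<omega> A"
  shows "D_matrix \<alpha> \<omega> A $ i $ j = D_matrix \<alpha> \<omega> A $ j $ i"
  using assms by (simp add: D_matrix_def balances_def)

text \<open>Positive weights and a positive exponent leave the set of positive entries of
  \<open>A\<close> unchanged, so strong connectivity is inherited; symmetry comes from detailed
  balance.\<close>

lemma lambda_omega_D_matrix_pos: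
  fixes A :: "real^'n^'n"
  assumes "CARD('n) \<ge> 2" "0 < \<alpha>" "nonneg_matrix A" "strongly_connected A" "balances \<omega> A"
  shows "lambda_omega \<omega> (laplacian (D_matrix \<alpha> \<omega> A)) > 0"
proof (rule lambda_omega_laplacian_pos[OF assms(1)])
  have "{(p, q). D_matrix \<alpha> \<omega> A $ p $ q > 0} = {(p, q). A $ p $ q > 0}"
    using assms(3,5)
    by (auto simp: D_matrix_def balances_def nonneg_matrix_def order_less_le)
  then show "strongly_connected (D_matrix \<alpha> \<omega> A)"
    using assms(4) by (simp add: strongly_connected_def)
qed (use assms in \<open>simp_all add: D_matrix_sym nonneg_matrix_def D_matrix_def balances_def\<close>)

lemma Max_weight_pos:
  fixes \<omega> :: "real^'n"
  assumes "\<And>i. \<omega> $ i > 0"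
  shows "Max (range (\<lambda>i. \<omega> $ i)) > 0"
  using assms by (subst Max_gr_iff) auto

lemma C3_pos:
  fixes A :: "real^'n^'n"
  assumes "CARD('n) \<ge> 2" "0 < \<alpha>" "nonneg_matrix A" "strongly_connected A" "balances \<omega> A"
  shows "C3 \<alpha> \<omega> A > 0"
  using lambda_omega_D_matrix_pos[OF assms] Max_weight_pos[of \<omega>] assms(5)
  by (simp add: C3_def balances_def)

text \<open>The deviation vector is orthogonal to \<open>\<omega>\<close>, so the minimality of
  \<open>lambda_omega\<close> applies to it. The factor 2 comes from counting each pair of nodes
  twice, the maximum from bounding the weights in the energy.\<close>

lemma lambda_omega_deviation_le:
  fixes A :: "real^'n^'n"
  assumes "CARD('n) \<ge> 2" "0 < \<alpha>" "nonneg_matrix A" "strongly_connected A" "balances \<omega> A"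
  shows "2 / Max (range (\<lambda>i. \<omega> $ i)) * lambda_omega \<omega> (laplacian (D_matrix \<alpha> \<omega> A))
      * (\<Sum>i\<in>UNIV. \<omega> $ i * (deviation \<omega> z i)\<^sup>2)
    \<le> (\<Sum>i\<in>UNIV. \<Sum>j\<in>UNIV. D_matrix \<alpha> \<omega> A $ i $ j * (z i - z j)\<^sup>2)"
proof -
  have pos: "\<And>i. \<omega> $ i > 0" using assms(5) by (simp add: balances_def)
  let ?m = "Max (range (\<lambda>i. \<omega> $ i))" and ?l = "lambda_omega \<omega> (laplacian (D_matrix \<alpha> \<omega> A))"
  let ?Q = "\<Sum>i\<in>UNIV. \<Sum>j\<in>UNIV. D_matrix \<alpha> \<omega> A $ i $ j * (z i - z j)\<^sup>2"
  define x where "x = (\<chi> i. deviation \<omega> z i)"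
  have "?m > 0" using Max_weight_pos[of \<omega>] pos .
  have "?l > 0" using lambda_omega_D_matrix_pos[OF assms] .
  have "x \<bullet> \<omega> = 0"
    using sum_deviation[of \<omega> z] pos by (simp add: x_def inner_vec_def mult.commute)
  then have "?l * (x \<bullet> x) \<le> x \<bullet> (laplacian (D_matrix \<alpha> \<omega> A) *v x)"
    using lambda_omega_attained[OF assms(1)] by metis
  then have *: "2 * (?l * (x \<bullet> x)) \<le> ?Q"
    using inner_laplacian[of "D_matrix \<alpha> \<omega> A" x, OF D_matrix_sym[OF assms(5)]]
    by (simp add: x_def deviation_diff)
  have "(\<Sum>i\<in>UNIV. \<omega> $ i * (deviation \<omega> z i)\<^sup>2) \<le> (\<Sum>i\<in>UNIV. ?m * (deviation \<omega> z i)\<^sup>2)"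
    by (intro sum_mono mult_right_mono) auto
  also have "\<dots> = ?m * (x \<bullet> x)"
    by (simp add: x_def inner_vec_def sum_distrib_left power2_eq_square)
  finally have "2 / ?m * ?l * (\<Sum>i\<in>UNIV. \<omega> $ i * (deviation \<omega> z i)\<^sup>2) \<le> 2 / ?m * ?l * (?m * (x \<bullet> x))"
    using \<open>?m > 0\<close> \<open>?l > 0\<close> by (intro mult_left_mono) auto
  with * \<open>?m > 0\<close> show ?thesis by simp
qed

section \<open>Contributions of diffusion and of the controller\<close>

text \<open>Integration by parts: \<open>?F\<close> vanishes at both ends, and its derivative
  \<open>?f\<close> exceeds the integrand by the sum of
  \<open>\<omega> $ i * ?d' i x * z' i x\<close>, which equals a weighted sum of squares of
  \<open>?d'\<close>.\<close>

lemma integral_deviation_diffusion_nonpos: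
  fixes \<omega> :: "real^'n" and z :: "'n \<Rightarrow> real \<Rightarrow> real"
  assumes "0 < L" and pos: "\<And>i. \<omega> $ i > 0"
    and z': "\<And>i x. x \<in> {0..L} \<Longrightarrow> (z i has_real_derivative z' i x) (at x within {0..L})"
    and z'': "\<And>i x. x \<in> {0..L} \<Longrightarrow> (z' i has_real_derivative z'' i x) (at x within {0..L})"
    and cont: "\<And>i. continuous_on {0..L} (z'' i)"
    and bdry: "\<And>i. z i 0 = 0" "\<And>i. z i L = 0"
  shows "integral {0..L} (\<lambda>x. \<Sum>i\<in>UNIV. \<omega> $ i * deviation \<omega> (\<lambda>i. z i x) i * z'' i x) \<le> 0"
proof -
  let ?d = "\<lambda>i x. deviation \<omega> (\<lambda>i. z i x) i"
  let ?d' = "\<lambda>i x. deviation \<omega> (\<lambda>i. z' i x) i"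
  let ?F = "\<lambda>x. \<Sum>i\<in>UNIV. \<omega> $ i * ?d i x * z' i x"
  let ?f = "\<lambda>x. \<Sum>i\<in>UNIV. \<omega> $ i * (?d i x * z'' i x + ?d' i x * z' i x)"
  have "(?F has_real_derivative ?f x) (at x within {0..L})" if "x \<in> {0..L}" for x
    by (rule derivative_eq_intros has_real_derivative_deviation z'[OF that] z''[OF that] refl)+
      (simp add: algebra_simps)
  then have "(?f has_integral (?F L - ?F 0)) {0..L}"
    using \<open>0 < L\<close> by (intro fundamental_theorem_of_calculus)
      (auto simp: has_real_derivative_iff_has_vector_derivative[symmetric])
  \<comment> \<open>All agents vanish at the ends, hence so does their mean; the boundary terms are
    0 whatever the slopes \<open>z'\<close> are there.\<close>
  moreover have "?d i 0 = 0" "?d i L = 0" for i using bdry by (simp_all add: deviation_def)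
  ultimately have f: "(?f has_integral 0) {0..L}" by simp
  have contz: "continuous_on {0..L} (z i)" for i
    using z' by (intro DERIV_continuous_on) auto
  have "((\<lambda>x. \<Sum>i\<in>UNIV. \<omega> $ i * ?d i x * z'' i x) has_integral
      integral {0..L} (\<lambda>x. \<Sum>i\<in>UNIV. \<omega> $ i * ?d i x * z'' i x)) {0..L}"
    by (intro integrable_integral integrable_continuous_real continuous_intros contz cont)
  then show ?thesis
  proof (rule has_integral_le[OF _ f])
    fix x
    have "0 \<le> (\<Sum>i\<in>UNIV. \<omega> $ i * ?d' i x * ?d' i x)"
      using pos by (intro sum_nonneg) (simp add: less_imp_le mult.assoc)
    also have "\<dots> = (\<Sum>i\<in>UNIV. \<omega> $ i * ?d' i x * z' i x)"
      using sum_deviation_mult[OF pos] .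
    finally show "(\<Sum>i\<in>UNIV. \<omega> $ i * ?d i x * z'' i x) \<le> ?f x"
      by (simp add: distrib_left sum.distrib mult.assoc)
  qed
qed

text \<open>The controller depends on differences of deviations only, with weights that become
  symmetric after multiplication by \<open>\<omega> $ i\<close>; then
  \<open>sum_weighted_differences\<close> applies.\<close>

lemma sum_deviation_control:
  fixes \<omega> :: "real^'n"
  assumes "balances \<omega> A"
  shows "2 * (\<Sum>i\<in>UNIV. \<omega> $ i * deviation \<omega> (\<lambda>i. y i x t) i * control \<alpha> L A y i x t)
    = - (\<Sum>i\<in>UNIV. \<Sum>j\<in>UNIV. \<omega> $ i * A $ i $ j *
          integral {0..L} (\<lambda>s. (xi y i j s t)\<^sup>2) powr (\<alpha> - 1) * (xi y i j x t)\<^sup>2)"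
proof -
  let ?d = "\<lambda>i. deviation \<omega> (\<lambda>i. y i x t) i"
  define w where "w i j = \<omega> $ i * A $ i $ j *
    integral {0..L} (\<lambda>s. (xi y i j s t)\<^sup>2) powr (\<alpha> - 1)" for i j
  \<comment> \<open>Detailed balance settles the matrix entries; the integral is symmetric since it
    contains only the square of \<open>xi\<close>.\<close>
  have sym: "w i j = w j i" for i j
    using assms by (simp add: w_def balances_def xi_def power2_commute[of "y i _ t"])
  have "2 * (\<Sum>i\<in>UNIV. \<omega> $ i * ?d i * control \<alpha> L A y i x t)
      = - (2 * (\<Sum>i\<in>UNIV. \<Sum>j\<in>UNIV. w i j * ?d i * (?d i - ?d j)))"
    by (simp add: control_def w_def deviation_diff xi_def sum_distrib_left sum_negf mult_ac)
  also have "\<dots> = - (\<Sum>i\<in>UNIV. \<Sum>j\<in>UNIV. w i j * (?d i - ?d j)\<^sup>2)"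
    using sum_weighted_differences[of w, OF sym] by simp
  finally show ?thesis by (simp add: deviation_diff w_def xi_def)
qed

text \<open>The spectral bound is first integrated over space and then raised to the power \<alpha>.
  Subadditivity splits the power, and \<alpha> cancels the exponent \<open>1 / \<alpha>\<close> in
  \<open>D_matrix\<close>, which returns the weights of the controller term.\<close>

lemma C3_mult_powr_le:
  fixes A :: "real^'n^'n" and y :: "'n \<Rightarrow> real \<Rightarrow> real \<Rightarrow> real"
  assumes "CARD('n) \<ge> 2" "0 < \<alpha>" "\<alpha> < 1"
    and A: "nonneg_matrix A" "strongly_connected A" and bal: "balances \<omega> A"
    and cont: "\<And>i. continuous_on {0..L} (\<lambda>x. y i x t)"
  shows "C3 \<alpha> \<omega> A * integral {0..L} (\<lambda>x. \<Sum>i\<in>UNIV. \<omega> $ i * (deviation \<omega> (\<lambda>i. y i x t) i)\<^sup>2) powr \<alpha>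
    \<le> integral {0..L} (\<lambda>x. \<Sum>i\<in>UNIV. \<Sum>j\<in>UNIV. \<omega> $ i * A $ i $ j *
          integral {0..L} (\<lambda>s. (xi y i j s t)\<^sup>2) powr (\<alpha> - 1) * (xi y i j x t)\<^sup>2)"
    (is "_ * ?V powr \<alpha> \<le> integral _ ?g")
proof -
  have pos: "\<And>i. \<omega> $ i > 0" using bal by (simp add: balances_def)
  define P where "P i j = integral {0..L} (\<lambda>s. (xi y i j s t)\<^sup>2)" for i j
  let ?D = "\<lambda>i j. D_matrix \<alpha> \<omega> A $ i $ j"
  let ?c = "2 / Max (range (\<lambda>i. \<omega> $ i)) * lambda_omega \<omega> (laplacian (D_matrix \<alpha> \<omega> A))"
  have intP [simp]: "(\<lambda>s. (xi y i j s t)\<^sup>2) integrable_on {0..L}" for i j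
    unfolding xi_def by (intro integrable_continuous_real continuous_intros cont)
  have P0: "0 \<le> P i j" for i j
    unfolding P_def by (intro integral_nonneg) auto
  have D0: "0 \<le> ?D i j" for i j by (simp add: D_matrix_def)
  have "?c > 0"
    using lambda_omega_D_matrix_pos[OF assms(1,2) A bal] Max_weight_pos[of \<omega>] pos by simp
  have V0: "0 \<le> ?V"
    using pos by (intro integral_nonneg integrable_continuous_real continuous_intros cont sum_nonneg)
      (simp add: less_imp_le)
  have "?c * ?V = integral {0..L} (\<lambda>x. ?c * (\<Sum>i\<in>UNIV. \<omega> $ i * (deviation \<omega> (\<lambda>i. y i x t) i)\<^sup>2))"
    by (rule integral_mult_right[symmetric])
  also have "\<dots> \<le> integral {0..L} (\<lambda>x. \<Sum>i\<in>UNIV. \<Sum>j\<in>UNIV. ?D i j * (xi y i j x t)\<^sup>2)"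
  proof (rule integral_le)
    show "?c * (\<Sum>i\<in>UNIV. \<omega> $ i * (deviation \<omega> (\<lambda>i. y i x t) i)\<^sup>2)
        \<le> (\<Sum>i\<in>UNIV. \<Sum>j\<in>UNIV. ?D i j * (xi y i j x t)\<^sup>2)" for x
      using lambda_omega_deviation_le[OF assms(1,2) A bal, of "\<lambda>i. y i x t"]
      by (simp add: xi_def)
  qed (unfold xi_def, (intro integrable_continuous_real continuous_intros cont)+)
  also have "\<dots> = (\<Sum>i\<in>UNIV. \<Sum>j\<in>UNIV. ?D i j * P i j)"
    by (simp add: integral_sum integrable_sum P_def integrable_on_mult_right)
  \<comment> \<open>A single sum over pairs lets subadditivity be applied once.\<close>
  also have "\<dots> = (\<Sum>(i, j)\<in>UNIV. ?D i j * P i j)"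
    by (simp add: sum.cartesian_product)
  finally have "?c * ?V \<le> (\<Sum>(i, j)\<in>UNIV. ?D i j * P i j)" .
  moreover have "0 \<le> ?c * ?V" by (rule mult_nonneg_nonneg[OF less_imp_le[OF \<open>?c > 0\<close>] V0])
  ultimately have "(?c * ?V) powr \<alpha> \<le> (\<Sum>(i, j)\<in>UNIV. ?D i j * P i j) powr \<alpha>"
    by (intro powr_mono2 less_imp_le[OF \<open>0 < \<alpha>\<close>])
  then have "C3 \<alpha> \<omega> A * ?V powr \<alpha> \<le> (\<Sum>(i, j)\<in>UNIV. ?D i j * P i j) powr \<alpha>"
    unfolding C3_def powr_mult .
  also have "\<dots> \<le> (\<Sum>p\<in>UNIV. (case p of (i, j) \<Rightarrow> ?D i j * P i j) powr \<alpha>)"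
    using assms(2,3) D0 P0 by (intro powr_sum_le_sum_powr) auto
  also have "\<dots> = (\<Sum>i\<in>UNIV. \<Sum>j\<in>UNIV. (?D i j * P i j) powr \<alpha>)"
    by (simp add: sum.cartesian_product case_prod_unfold)
  also have "\<dots> = (\<Sum>i\<in>UNIV. \<Sum>j\<in>UNIV. \<omega> $ i * A $ i $ j * P i j powr (\<alpha> - 1) * P i j)"
  proof (intro sum.cong refl)
    fix i j
    have "0 \<le> \<omega> $ i * A $ i $ j"
      using pos A(1) by (simp add: nonneg_matrix_def less_imp_le)
    then have "?D i j powr \<alpha> = \<omega> $ i * A $ i $ j"
      using \<open>0 < \<alpha>\<close> by (simp add: D_matrix_def powr_powr)
    \<comment> \<open>For \<open>P i j = 0\<close> both sides are 0, since \<open>powr\<close> with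
      base 0 is 0 for every exponent.\<close>
    moreover have "P i j powr \<alpha> = P i j powr (\<alpha> - 1) * P i j"
      using P0[of i j] by (cases "P i j = 0") (simp_all add: powr_diff)
    ultimately show "(?D i j * P i j) powr \<alpha> = \<omega> $ i * A $ i $ j * P i j powr (\<alpha> - 1) * P i j"
      using D0 P0 by (simp add: powr_mult)
  qed
  also have "\<dots> = integral {0..L} ?g"
    by (simp add: integral_sum integrable_sum P_def integrable_on_mult_right)
  finally show ?thesis .
qed

section \<open>Regularity of the energy in time\<close>

text \<open>Continuity may fail at the two corners, so uniform continuity is replaced by dominated
  convergence along sequences of times, the local bound serving as majorant.\<close>

lemma continuous_on_integral_bounded:
  fixes f :: "real \<Rightarrow> real \<Rightarrow> real"
  assumes cont: "continuous_on ({0..L} \<times> {0..} - {(0, 0), (L, 0)}) (\<lambda>(x, t). f x t)"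
    and cont0: "continuous_on {0..L} (\<lambda>x. f x 0)"
    and bdd: "\<And>T. bounded ((\<lambda>(x, t). f x t) ` ({0..L} \<times> {0..T}))"
  shows "continuous_on {0..} (\<lambda>t. integral {0..L} (\<lambda>x. f x t))"
  unfolding continuous_on_sequentially
proof (intro allI ballI impI, elim conjE)
  fix s :: "nat \<Rightarrow> real" and a
  assume a: "a \<in> {0..}" and s: "\<forall>n. s n \<in> {0..}" "s \<longlonglongrightarrow> a"
  from s(2) have "bounded (range s)" by (rule convergent_imp_bounded)
  then obtain T where T: "\<And>n. s n \<le> T" by (auto simp: bounded_iff abs_le_iff)
  from bdd[of T] obtain B where B: "\<And>x t. x \<in> {0..L} \<Longrightarrow> t \<in> {0..T} \<Longrightarrow> norm (f x t) \<le> B"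
    unfolding bounded_iff by fastforce
  \<comment> \<open>The slice at time 0 passes through the corners; its continuity is supplied by
    \<open>cont0\<close>.\<close>
  have slice: "continuous_on {0..L} (\<lambda>x. f x t)" if "t \<ge> 0" for t
  proof (cases "t = 0")
    case False
    then show ?thesis
      using that continuous_on_compose2[OF cont, of "{0..L}" "\<lambda>x. (x, t)"]
      by (force intro: continuous_intros)
  qed (use cont0 in simp)
  \<comment> \<open>For \<open>x\<close> in the open interval the line of all times at
    \<open>x\<close> avoids the corners, so pointwise convergence holds at every point.\<close>
  have "(\<lambda>n. integral {0<..<L} (\<lambda>x. f x (s n))) \<longlonglongrightarrow> integral {0<..<L} (\<lambda>x. f x a)"
  proof (rule dominated_convergence(2))
    show "(\<lambda>x. f x (s n)) integrable_on {0<..<L}" for n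
      using slice[of "s n"] s(1) by (simp add: integrable_continuous_real integrable_on_open_interval_real)
    show "(\<lambda>x. B) integrable_on {0<..<L}"
      by (simp add: integrable_on_open_interval_real integrable_const_ivl)
    show "norm (f x (s n)) \<le> B" if "x \<in> {0<..<L}" for n x
      using B that s(1) T by auto
    show "(\<lambda>n. f x (s n)) \<longlonglongrightarrow> f x a" if "x \<in> {0<..<L}" for x
    proof -
      have "continuous_on {0..} (\<lambda>t. f x t)"
        using that continuous_on_compose2[OF cont, of "{0..}" "\<lambda>t. (x, t)"]
        by (force intro: continuous_intros)
      then show ?thesis
        using a s unfolding continuous_on_sequentially by (auto simp: o_def)
    qed
  qed
  then show "((\<lambda>t. integral {0..L} (\<lambda>x. f x t)) \<circ> s) \<longlonglongrightarrow> integral {0..L} (\<lambda>x. f x a)"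
    by (simp add: o_def integral_open_interval_real)
qed

text \<open>Bounded states lie in a ball of the finite-dimensional state space, and the energy
  density is a continuous function on that compact ball.\<close>

lemma bounded_deviation_energy:
  fixes \<omega> :: "real^'n" and y :: "'n \<Rightarrow> real \<Rightarrow> real \<Rightarrow> real"
  assumes "\<And>i. bounded ((\<lambda>(x, t). y i x t) ` K)"
  shows "bounded ((\<lambda>(x, t). \<Sum>i\<in>UNIV. \<omega> $ i * (deviation \<omega> (\<lambda>i. y i x t) i)\<^sup>2) ` K)"
proof -
  have "\<forall>i. \<exists>B. \<forall>p\<in>K. \<bar>case p of (x, t) \<Rightarrow> y i x t\<bar> \<le> B"
    using assms unfolding bounded_iff by simp
  then obtain B where B: "\<And>i p. p \<in> K \<Longrightarrow> \<bar>case p of (x, t) \<Rightarrow> y i x t\<bar> \<le> B i" by metis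
  let ?q = "\<lambda>v. \<Sum>i\<in>UNIV. \<omega> $ i * (deviation \<omega> (\<lambda>i. v $ i) i)\<^sup>2"
  let ?C = "cball 0 (\<Sum>i\<in>UNIV. B i) :: (real^'n) set"
  have "bounded (?q ` ?C)"
    by (intro compact_imp_bounded compact_continuous_image continuous_intros) simp_all
  moreover have "(\<lambda>(x, t). \<Sum>i\<in>UNIV. \<omega> $ i * (deviation \<omega> (\<lambda>i. y i x t) i)\<^sup>2) ` K \<subseteq> ?q ` ?C"
  proof safe
    fix x t assume p: "(x, t) \<in> K"
    have "norm (\<chi> i. y i x t) \<le> (\<Sum>i\<in>UNIV. \<bar>y i x t\<bar>)"
      using norm_le_l1_cart[of "\<chi> i. y i x t"] by simp
    also have "\<dots> \<le> (\<Sum>i\<in>UNIV. B i)" using B[OF p] by (intro sum_mono) simp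
    finally have "(\<chi> i. y i x t) \<in> ?C" by simp
    then show "(\<Sum>i\<in>UNIV. \<omega> $ i * (deviation \<omega> (\<lambda>i. y i x t) i)\<^sup>2) \<in> ?q ` ?C"
      by (intro image_eqI[where x = "\<chi> i. y i x t"]) simp_all
  qed
  ultimately show ?thesis by (rule bounded_subset)
qed

text \<open>Differentiation under the integral; the derivative of the mean drops out by
  \<open>sum_deviation_mult\<close>.\<close>

lemma has_real_derivative_deviation_energy:
  fixes \<omega> :: "real^'n" and y :: "'n \<Rightarrow> real \<Rightarrow> real \<Rightarrow> real"
  assumes pos: "\<And>i. \<omega> $ i > 0" and "open U" "t \<in> U"
    and deriv: "\<And>i x s. x \<in> {0..L} \<Longrightarrow> s \<in> U \<Longrightarrow> ((\<lambda>s. y i x s) has_real_derivative y_t i x s) (at s)"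
    and cont: "\<And>i. continuous_on ({0..L} \<times> U) (\<lambda>(x, s). y i x s)"
    and cont_t: "\<And>i. continuous_on ({0..L} \<times> U) (\<lambda>(x, s). y_t i x s)"
  shows "((\<lambda>s. integral {0..L} (\<lambda>x. \<Sum>i\<in>UNIV. \<omega> $ i * (deviation \<omega> (\<lambda>i. y i x s) i)\<^sup>2))
    has_real_derivative
      integral {0..L} (\<lambda>x. 2 * (\<Sum>i\<in>UNIV. \<omega> $ i * deviation \<omega> (\<lambda>i. y i x t) i * y_t i x t))) (at t)"
proof -
  \<comment> \<open>The Leibniz rule asks for a convex set of parameters, hence a ball inside
    \<open>U\<close>.\<close>
  obtain e where e: "e > 0" "ball t e \<subseteq> U" using \<open>open U\<close> \<open>t \<in> U\<close> open_contains_ball by blast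
  \<comment> \<open>The Leibniz rule takes the parameter first, whereas the state takes position
    first.\<close>
  have swap: "continuous_on (ball t e \<times> {0..L}) (\<lambda>p. g (snd p) (fst p))"
    if "continuous_on ({0..L} \<times> U) (\<lambda>(x, s). g x s)" for g :: "real \<Rightarrow> real \<Rightarrow> real"
    using continuous_on_compose2[OF that, of "ball t e \<times> {0..L}" "\<lambda>p. (snd p, fst p)"] e
    by (force intro: continuous_intros)
  have slice: "continuous_on {0..L} (\<lambda>x. y i x s)" if "s \<in> ball t e" for i s
    using continuous_on_compose2[OF cont, of "{0..L}" "\<lambda>x. (x, s)"] e that
    by (force intro: continuous_intros)
  have "((\<lambda>s. integral (cbox 0 L) (\<lambda>x. \<Sum>i\<in>UNIV. \<omega> $ i * (deviation \<omega> (\<lambda>i. y i x s) i)\<^sup>2))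
    has_real_derivative
      integral (cbox 0 L) (\<lambda>x. 2 * (\<Sum>i\<in>UNIV. \<omega> $ i * deviation \<omega> (\<lambda>i. y i x t) i * y_t i x t)))
      (at t within ball t e)"
  proof (rule leibniz_rule_field_derivative)
    fix s x assume s: "s \<in> ball t e" and x: "x \<in> cbox 0 L"
    with e have d: "(y i x has_real_derivative y_t i x s) (at s within ball t e)" for i
      by (intro DERIV_subset[OF deriv]) auto
    have "(\<Sum>i\<in>UNIV. \<omega> $ i * (2 * (deviation \<omega> (\<lambda>i. y i x s) i * deviation \<omega> (\<lambda>i. y_t i x s) i)))
        = 2 * (\<Sum>i\<in>UNIV. \<omega> $ i * deviation \<omega> (\<lambda>i. y i x s) i * deviation \<omega> (\<lambda>i. y_t i x s) i)"
      by (simp add: sum_distrib_left mult_ac)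
    also have "\<dots> = 2 * (\<Sum>i\<in>UNIV. \<omega> $ i * deviation \<omega> (\<lambda>i. y i x s) i * y_t i x s)"
      using sum_deviation_mult[OF pos] by simp
    finally have eq: "(\<Sum>i\<in>UNIV. \<omega> $ i * (2 * (deviation \<omega> (\<lambda>i. y i x s) i * deviation \<omega> (\<lambda>i. y_t i x s) i)))
        = 2 * (\<Sum>i\<in>UNIV. \<omega> $ i * deviation \<omega> (\<lambda>i. y i x s) i * y_t i x s)" .
    show "((\<lambda>s. \<Sum>i\<in>UNIV. \<omega> $ i * (deviation \<omega> (\<lambda>i. y i x s) i)\<^sup>2) has_real_derivative
        2 * (\<Sum>i\<in>UNIV. \<omega> $ i * deviation \<omega> (\<lambda>i. y i x s) i * y_t i x s)) (at s within ball t e)"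
      unfolding eq[symmetric] power2_eq_square
      by (rule derivative_eq_intros has_real_derivative_deviation d refl)+ (simp add: algebra_simps)
  next
    fix s assume "s \<in> ball t e"
    from slice[OF this]
    show "(\<lambda>x. \<Sum>i\<in>UNIV. \<omega> $ i * (deviation \<omega> (\<lambda>i. y i x s) i)\<^sup>2) integrable_on cbox 0 L"
      by (auto intro!: integrable_continuous_real continuous_intros)
  next
    show "continuous_on (ball t e \<times> cbox 0 L)
      (\<lambda>(s, x). 2 * (\<Sum>i\<in>UNIV. \<omega> $ i * deviation \<omega> (\<lambda>i. y i x s) i * y_t i x s))"
      unfolding case_prod_unfold cbox_interval
      by (intro continuous_intros swap cont cont_t)
  qed (use e in auto)
  then show ?thesis using e by (simp add: at_within_open[of t "ball t e"])
qed

section \<open>Decay and extinction of the energy\<close>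

text \<open>Inserting the equation splits the derivative into a nonpositive diffusion term and the
  controller term, which \<open>C3_mult_powr_le\<close> controls.\<close>

lemma deviation_energy_decay:
  fixes A :: "real^'n^'n" and y :: "'n \<Rightarrow> real \<Rightarrow> real \<Rightarrow> real"
  assumes "CARD('n) \<ge> 2" "0 < \<alpha>" "\<alpha> < 1" "0 < L" "0 < k"
    and A: "nonneg_matrix A" "strongly_connected A" and bal: "balances \<omega> A"
    and bdry: "\<And>i. y i 0 t = 0" "\<And>i. y i L t = 0"
    and cont_t: "\<And>i. continuous_on {0..L} (y_t i)"
    and y_x: "\<And>i x. x \<in> {0..L} \<Longrightarrow> ((\<lambda>z. y i z t) has_real_derivative y_x i x) (at x within {0..L})"
    and y_xx: "\<And>i x. x \<in> {0..L} \<Longrightarrow> (y_x i has_real_derivative y_xx i x) (at x within {0..L})"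
    and eq: "\<And>i x. x \<in> {0..L} \<Longrightarrow> y_t i x = k * y_xx i x + control \<alpha> L A y i x t"
  shows "integral {0..L} (\<lambda>x. 2 * (\<Sum>i\<in>UNIV. \<omega> $ i * deviation \<omega> (\<lambda>i. y i x t) i * y_t i x))
    \<le> - C3 \<alpha> \<omega> A *
        integral {0..L} (\<lambda>x. \<Sum>i\<in>UNIV. \<omega> $ i * (deviation \<omega> (\<lambda>i. y i x t) i)\<^sup>2) powr \<alpha>"
proof -
  let ?d = "\<lambda>i x. deviation \<omega> (\<lambda>i. y i x t) i"
  let ?f = "\<lambda>x. \<Sum>i\<in>UNIV. \<omega> $ i * ?d i x * y_xx i x"
  let ?g = "\<lambda>x. \<Sum>i\<in>UNIV. \<Sum>j\<in>UNIV. \<omega> $ i * A $ i $ j *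
    integral {0..L} (\<lambda>s. (xi y i j s t)\<^sup>2) powr (\<alpha> - 1) * (xi y i j x t)\<^sup>2"
  have cont: "continuous_on {0..L} (\<lambda>x. y i x t)" for i
    using y_x by (intro DERIV_continuous_on) auto
  \<comment> \<open>Solving the equation for \<open>y_xx\<close> yields its continuity, which makes
    the diffusion term integrable.\<close>
  have "continuous_on {0..L} (\<lambda>x. (y_t i x - control \<alpha> L A y i x t) / k)" for i
    unfolding control_def xi_def using \<open>0 < k\<close> by (intro continuous_intros cont cont_t) auto
  then have cont_xx: "continuous_on {0..L} (y_xx i)" for i
    by (rule continuous_on_eq) (use eq \<open>0 < k\<close> in auto)
  have "integral {0..L} (\<lambda>x. 2 * (\<Sum>i\<in>UNIV. \<omega> $ i * ?d i x * y_t i x))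
      = integral {0..L} (\<lambda>x. 2 * k * ?f x - ?g x)"
  proof (rule integral_cong)
    fix x assume "x \<in> {0..L}"
    then have "2 * (\<Sum>i\<in>UNIV. \<omega> $ i * ?d i x * y_t i x)
        = 2 * k * ?f x + 2 * (\<Sum>i\<in>UNIV. \<omega> $ i * ?d i x * control \<alpha> L A y i x t)"
      by (simp add: eq distrib_left sum.distrib sum_distrib_left mult_ac)
    then show "2 * (\<Sum>i\<in>UNIV. \<omega> $ i * ?d i x * y_t i x) = 2 * k * ?f x - ?g x"
      using sum_deviation_control[OF bal, of y x t \<alpha> L] by simp
  qed
  also have "\<dots> = integral {0..L} (\<lambda>x. 2 * k * ?f x) - integral {0..L} ?g"
    unfolding xi_def
    by (intro integral_diff integrable_continuous_real continuous_intros cont cont_xx)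
  also have "integral {0..L} (\<lambda>x. 2 * k * ?f x) = 2 * k * integral {0..L} ?f"
    by (rule integral_mult_right)
  also have "\<dots> \<le> 0"
    using integral_deviation_diffusion_nonpos[OF \<open>0 < L\<close> _ y_x y_xx cont_xx bdry, of \<omega>] bal \<open>0 < k\<close>
    by (intro mult_nonneg_nonpos) (auto simp: balances_def)
  finally show ?thesis
    using C3_mult_powr_le[where y = y and t = t, OF assms(1-3) A bal cont] by simp
qed

text \<open>A continuous nonnegative density with zero integral vanishes everywhere, and positive
  weights then annihilate each deviation.\<close>

lemma deviation_energy_eq_0:
  fixes \<omega> :: "real^'n" and z :: "'n \<Rightarrow> real \<Rightarrow> real"
  assumes "0 < L" and pos: "\<And>i. \<omega> $ i > 0" and cont: "\<And>i. continuous_on {0..L} (z i)"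
    and zero: "integral {0..L} (\<lambda>x. \<Sum>i\<in>UNIV. \<omega> $ i * (deviation \<omega> (\<lambda>i. z i x) i)\<^sup>2) = 0"
    and x: "x \<in> {0..L}"
  shows "z i x = z j x"
proof -
  let ?q = "\<lambda>x. \<Sum>i\<in>UNIV. \<omega> $ i * (deviation \<omega> (\<lambda>i. z i x) i)\<^sup>2"
  have nonneg: "0 \<le> \<omega> $ i * (deviation \<omega> (\<lambda>i. z i x) i)\<^sup>2" for i x
    using pos by (simp add: less_imp_le)
  have contq: "continuous_on (cbox 0 L) ?q" 
    using cont by (auto intro!: continuous_intros)
  have "(?q has_integral 0) (cbox 0 L)"
    using zero integrable_integral[OF integrable_continuous[OF contq]] by simp
  then have "?q x = 0"
    by (rule has_integral_0_cbox_imp_0[OF contq sum_nonneg[OF nonneg]]) (use \<open>0 < L\<close> x in auto)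
  then have "\<omega> $ i * (deviation \<omega> (\<lambda>i. z i x) i)\<^sup>2 = 0" for i
    using nonneg by (simp add: sum_nonneg_eq_0_iff)
  then have "deviation \<omega> (\<lambda>i. z i x) i = 0" for i
    using pos[of i] by (metis mult_eq_0_iff less_irrefl power_eq_0_iff)
  then show ?thesis using deviation_diff[of \<omega> "\<lambda>i. z i x" i j] by simp
qed

text \<open>The energy is continuous on all nonnegative times, including the exceptional ones, and
  decays off the countable set \<open>S\<close>, so \<open>finite_time_extinction\<close>
  applies.\<close>

lemma solution_deviation_energy_extinct:
  fixes A :: "real^'n^'n" and y :: "'n \<Rightarrow> real \<Rightarrow> real \<Rightarrow> real"
  assumes "CARD('n) \<ge> 2" "0 < \<alpha>" "\<alpha> < 1" "0 < L" "0 < k"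
    and A: "nonneg_matrix A" "strongly_connected A" and bal: "balances \<omega> A"
    and cont0: "\<And>i. continuous_on {0..L} (y0 i)"
    and sol: "solution \<alpha> L k A y0 y"
  defines "V \<equiv> \<lambda>t. integral {0..L} (\<lambda>x. \<Sum>i\<in>UNIV. \<omega> $ i * (deviation \<omega> (\<lambda>i. y i x t) i)\<^sup>2)"
  assumes t: "V 0 powr (1 - \<alpha>) / (C3 \<alpha> \<omega> A * (1 - \<alpha>)) \<le> t"
  shows "V t = 0"
proof -
  have pos: "\<And>i. \<omega> $ i > 0" using bal by (simp add: balances_def)
  have init: "\<And>i x. x \<in> {0..L} \<Longrightarrow> y i x 0 = y0 i x"
    and bdry: "\<And>i t. t > 0 \<Longrightarrow> y i 0 t = 0" "\<And>i t. t > 0 \<Longrightarrow> y i L t = 0"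
    and cont: "\<And>i. continuous_on ({0..L} \<times> {0..} - {(0, 0), (L, 0)}) (\<lambda>(x, t). y i x t)"
    and bdd: "\<And>i T. bounded ((\<lambda>(x, t). y i x t) ` ({0..L} \<times> {0..T}))"
    using sol unfolding solution_def by simp_all
  obtain S y_t y_x y_xx where S: "closed S" "countable S"
    and cont_t: "\<forall>i. continuous_on ({0..L} \<times> ({0<..} - S)) (\<lambda>(x, t). y_t i x t)"
    and deriv: "\<forall>i. \<forall>x\<in>{0..L}. \<forall>t\<in>{0<..} - S.
        ((\<lambda>s. y i x s) has_real_derivative y_t i x t) (at t) \<and>
        ((\<lambda>z. y i z t) has_real_derivative y_x i x t) (at x within {0..L}) \<and>
        ((\<lambda>z. y_x i z t) has_real_derivative y_xx i x t) (at x within {0..L}) \<and>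
        y_t i x t = k * y_xx i x t + control \<alpha> L A y i x t"
    using sol unfolding solution_def by (elim conjE exE) (rule that; assumption)
  let ?q = "\<lambda>x t. \<Sum>i\<in>UNIV. \<omega> $ i * (deviation \<omega> (\<lambda>i. y i x t) i)\<^sup>2"
  have contq: "continuous_on ({0..L} \<times> {0..} - {(0, 0), (L, 0)}) (\<lambda>(x, t). ?q x t)"
    unfolding case_prod_unfold by (intro continuous_intros cont[unfolded case_prod_unfold])
  \<comment> \<open>At time 0 continuity up to the end points is inherited from the initial
    profiles.\<close>
  have "continuous_on {0..L} (\<lambda>x. y i x 0)" for i
    using cont0[of i] by (rule continuous_on_eq) (simp add: init)
  then have "continuous_on {0..L} (\<lambda>x. ?q x 0)" by (intro continuous_intros)
  then have contV: "continuous_on {0..} V"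
    unfolding V_def by (rule continuous_on_integral_bounded[OF contq _ bounded_deviation_energy[OF bdd]])
  \<comment> \<open>Integrability is not at issue here: a nonintegrable function has integral 0 by
    default.\<close>
  have nonneg: "V t \<ge> 0" for t
  proof -
    have "0 \<le> (\<Sum>i\<in>UNIV. \<omega> $ i * (deviation \<omega> (\<lambda>i. y i x t) i)\<^sup>2)" for x
      using pos by (intro sum_nonneg) (simp add: less_imp_le)
    then show ?thesis unfolding V_def
      by (metis (no_types, lifting) integral_nonneg not_integrable_integral order_refl)
  qed
  have decay: "\<exists>D\<le>- C3 \<alpha> \<omega> A * V t powr \<alpha>. (V has_real_derivative D) (at t)" if t: "t \<in> {0<..} - S" for t
  proof -
    have "t > 0" using t by simp
    have cont_yt: "continuous_on {0..L} (\<lambda>x. y_t i x t)" for i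
      using continuous_on_compose2[OF cont_t[rule_format], of "{0..L}" "\<lambda>x. (x, t)"] t
      by (force intro: continuous_intros)
    have "(V has_real_derivative
        integral {0..L} (\<lambda>x. 2 * (\<Sum>i\<in>UNIV. \<omega> $ i * deviation \<omega> (\<lambda>i. y i x t) i * y_t i x t))) (at t)"
      unfolding V_def
    proof (rule has_real_derivative_deviation_energy[OF pos _ t])
      \<comment> \<open>Closedness of \<open>S\<close> leaves a neighbourhood of \<open>t\<close>
        free of exceptional times.\<close>
      show "open ({0<..} - S)" using S by (intro open_Diff) auto
      show "continuous_on ({0..L} \<times> ({0<..} - S)) (\<lambda>(x, s). y i x s)" for i
        by (rule continuous_on_subset[OF cont]) auto
    qed (use deriv cont_t in \<open>blast+\<close>)
    moreover have "integral {0..L} (\<lambda>x. 2 * (\<Sum>i\<in>UNIV. \<omega> $ i * deviation \<omega> (\<lambda>i. y i x t) i * y_t i x t))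
        \<le> - C3 \<alpha> \<omega> A * V t powr \<alpha>"
      unfolding V_def
      by (rule deviation_energy_decay[OF assms(1-5) A bal, where y_x = "\<lambda>i x. y_x i x t"
            and y_xx = "\<lambda>i x. y_xx i x t" and y_t = "\<lambda>i x. y_t i x t"])
        (use cont_yt deriv t bdry[OF \<open>t > 0\<close>] in \<open>blast+\<close>)
    ultimately show ?thesis by blast
  qed
  show ?thesis
    by (rule finite_time_extinction[OF assms(2,3) C3_pos[OF assms(1,2) A bal] S(2) contV nonneg decay t])
qed

theorem theorem3p3:
  fixes \<alpha> L k :: real
    and A :: "real^'n^'n"
    and \<omega> :: "real^'n"
    and y0 :: "'n \<Rightarrow> real \<Rightarrow> real"
    and y :: "'n \<Rightarrow> real \<Rightarrow> real \<Rightarrow> real"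
  assumes "0 < \<alpha>" "\<alpha> < 1" "0 < L" "0 < k"
    and "nonneg_matrix A" "strongly_connected A" "detail_balanced A"
    and "balances \<omega> A"
    and "\<And>i. bounded (y0 i ` {0..L})"
    and "\<And>i. continuous_on {0..L} (y0 i)"
    and "solution \<alpha> L k A y0 y"
  shows "achieves_FTC L y \<and>
    (\<exists>tstar. terminal_time L y tstar \<and>
       tstar \<le> (integral {0..L}
                  (\<lambda>x. \<Sum>i\<in>UNIV. \<omega> $ i * (y0 i x - weighted_mean \<omega> y0 x)\<^sup>2)) powr (1 - \<alpha>)
                / (C3 \<alpha> \<omega> A * (1 - \<alpha>)))"
proof -
  define V where "V t = integral {0..L} (\<lambda>x. \<Sum>i\<in>UNIV. \<omega> $ i * (deviation \<omega> (\<lambda>i. y i x t) i)\<^sup>2)" for t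
  \<comment> \<open>The claimed bound itself serves as terminal time.\<close>
  define T where "T = V 0 powr (1 - \<alpha>) / (C3 \<alpha> \<omega> A * (1 - \<alpha>))"
  have pos: "\<And>i. \<omega> $ i > 0" using assms(8) by (simp add: balances_def)
  have init: "\<And>i x. x \<in> {0..L} \<Longrightarrow> y i x 0 = y0 i x"
    and cont: "\<And>i. continuous_on ({0..L} \<times> {0..} - {(0, 0), (L, 0)}) (\<lambda>(x, t). y i x t)"
    using assms(11) unfolding solution_def by simp_all
  have V0: "V 0 = integral {0..L} (\<lambda>x. \<Sum>i\<in>UNIV. \<omega> $ i * (y0 i x - weighted_mean \<omega> y0 x)\<^sup>2)"
    unfolding V_def minus_weighted_mean by (rule integral_cong) (simp add: init)
  \<comment> \<open>This covers a single node too: \<open>C3\<close> is a value of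
    \<open>powr\<close>, hence nonnegative, and division by 0 gives 0.\<close>
  have "0 \<le> T" using \<open>\<alpha> < 1\<close> by (simp add: T_def C3_def)
  \<comment> \<open>Positive times keep the slices clear of the corners, and the limit at
    \<open>T = 0\<close> involves only such times.\<close>
  have consensus: "y i x t = y j x t" if "t > 0" "t \<ge> T" "x \<in> {0..L}" for i j x t
  proof (cases "CARD('n) \<ge> 2")
    case True
    have "continuous_on {0..L} (\<lambda>x. y i x t)" for i
      using \<open>t > 0\<close> continuous_on_compose2[OF cont, of "{0..L}" "\<lambda>x. (x, t)"]
      by (force intro: continuous_intros)
    moreover have "V t = 0"
      using solution_deviation_energy_extinct[OF True assms(1-6,8,10,11), of t] \<open>t \<ge> T\<close>
      by (simp add: V_def T_def)
    ultimately show ?thesis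
      using deviation_energy_eq_0[OF \<open>0 < L\<close> pos, of "\<lambda>i x. y i x t"] \<open>x \<in> {0..L}\<close>
      by (simp add: V_def)
  next
    \<comment> \<open>A single node: \<open>lambda_omega\<close> is unspecified, but there is nothing to synchronise.\<close>
    case False
    moreover have "card {i, j} \<le> CARD('n)" by (intro card_mono) auto
    ultimately show ?thesis by (cases "i = j") auto
  qed
  have "((\<lambda>t. \<bar>y i x t - y j x t\<bar>) \<longlongrightarrow> 0) (at T within {0..})" if x: "x \<in> {0..L}" for i j x
  proof (cases "T = 0")
    case True
    \<comment> \<open>The limit at 0 is one-sided, and the difference is already 0 at all positive
      times.\<close>
    have "\<forall>\<^sub>F t in at T within {0..}. \<bar>y i x t - y j x t\<bar> = 0"
      using consensus x True by (auto simp: eventually_at_filter)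
    then show ?thesis by (rule tendsto_eventually)
  next
    case False
    with \<open>0 \<le> T\<close> have "T > 0" by simp
    \<comment> \<open>Consensus is known only from \<open>T\<close> on, so the limit from the left
      relies on continuity in time, which holds even if \<open>T\<close> is an exceptional
      time.\<close>
    have "((\<lambda>t. y i x t) \<longlongrightarrow> y i x T) (at T within {0..})" for i
    proof -
      have "continuous_on {0<..} (\<lambda>t. y i x t)"
        using x continuous_on_compose2[OF cont, of "{0<..}" "\<lambda>t. (x, t)"]
        by (force intro: continuous_intros)
      then have "isCont (\<lambda>t. y i x t) T"
        using \<open>T > 0\<close> by (simp add: continuous_on_eq_continuous_at)
      then show ?thesis by (auto simp: isCont_def intro: tendsto_within_subset)
    qed
    from tendsto_rabs[OF tendsto_diff[OF this[of i] this[of j]]]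
    show ?thesis using consensus[OF \<open>T > 0\<close> _ x, of i j] by simp
  qed
  with \<open>0 \<le> T\<close> have "terminal_time L y T" by (simp add: terminal_time_def)
  then show ?thesis unfolding achieves_FTC_def T_def V0 by blast
qed

end
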